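(* Let $\mathcal{H}(x,t)$ be a smooth real function of $x\in\mathbb{R}^2$ and time $t$, let $S=\begin{pmatrix}0&1\\-1&0\end{pmatrix}$, and consider the planar Hamiltonian system $\dot{x}=S\nabla\mathcal{H}(x,t)$. Let $x=f(y)$ be a smooth mapping of planar regions whose Jacobian matrix $J(y)=\nabla f(y)$, $J_{mk}=\partial x_m/\partial y_k$, is non-singular on the region considered. Let $J=Qh$ be the polar decomposition of $J$, with $Q$ orthogonal and $h$ positive definite, let $g=h^Th$ be the metric tensor of $f$, and set $\widetilde{\mathcal{H}}(y,t)=\mathcal{H}(f(y),t)$. Then under $x=f(y)$ the Hamiltonian system is transformed into $$\dot{y}=\pm\frac{1}{\sqrt{\det[g(y)]}}\,S\nabla_y\widetilde{\mathcal{H}}(y,t),$$ where the sign is $+$ if $\det Q=1$ and $-$ if $\det Q=-1$.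
   Context: All quantities are real. $[\nabla(\cdot)]_m=\partial(\cdot)/\partial x_m$ and $(\nabla_y)_m=\partial/\partial y_m$; a dot denotes the total time derivative. Note that $g=J^TJ$. That the system is transformed means: if $y(t)$ is a smooth curve in the region considered and $x(t)=f(y(t))$ satisfies the original Hamiltonian system, then $y(t)$ satisfies the displayed system. *)

theory Defs
  imports "HOL-Analysis.Analysis"
begin

(* All directional derivatives up to order k exist and are continuous; on an open set in a
   finite-dimensional space this is the usual class C^k.  Only meant for open U, since the
   derivatives are taken in full neighbourhoods. *)
primrec Ck_on :: "nat \<Rightarrow> 'a::real_normed_vector set \<Rightarrow> ('a \<Rightarrow> 'b::real_normed_vector) \<Rightarrow> bool"
  where
    "Ck_on 0 U f \<longleftrightarrow> continuous_on U f"
  | "Ck_on (Suc k) U f \<longleftrightarrow>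
       (\<forall>x\<in>U. f differentiable (at x)) \<and>
       (\<forall>v. Ck_on k U (\<lambda>x. frechet_derivative f (at x) v))"

definition smooth_on :: "'a::real_normed_vector set \<Rightarrow> ('a \<Rightarrow> 'b::real_normed_vector) \<Rightarrow> bool"
  where "smooth_on U f \<longleftrightarrow> (\<forall>k. Ck_on k U f)"

definition region :: "'a::topological_space set \<Rightarrow> bool"
  where "region U \<longleftrightarrow> open U \<and> connected U \<and> U \<noteq> {}"

definition partial_deriv :: "'n \<Rightarrow> (real^'n \<Rightarrow> real) \<Rightarrow> real^'n \<Rightarrow> real"
  where "partial_deriv m F x = deriv (\<lambda>s. F (x + s *\<^sub>R axis m 1)) 0"

definition gradient :: "(real^'n \<Rightarrow> real) \<Rightarrow> real^'n \<Rightarrow> real^'n"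
  where "gradient F x = (\<chi> m. partial_deriv m F x)"

definition S_mat :: "real^2^2"
  where "S_mat = vector [vector [0, 1], vector [-1, 0]]"

definition positive_definite :: "real^'n^'n \<Rightarrow> bool"
  where "positive_definite A \<longleftrightarrow> transpose A = A \<and> (\<forall>v. v \<noteq> 0 \<longrightarrow> v \<bullet> (A *v v) > 0)"

definition polar_decomposition :: "real^'n^'n \<Rightarrow> real^'n^'n \<Rightarrow> real^'n^'n \<Rightarrow> bool"
  where "polar_decomposition A Q h \<longleftrightarrow>
    A = Q ** h \<and> orthogonal_matrix Q \<and> positive_definite h"

(* Meant for open time sets T. *)
definition solves_on :: "real set \<Rightarrow> ('a::real_normed_vector \<Rightarrow> real \<Rightarrow> 'a) \<Rightarrow> (real \<Rightarrow> 'a) \<Rightarrow> bool"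
  where "solves_on T F x \<longleftrightarrow> (\<forall>t\<in>T. (x has_vector_derivative F (x t) t) (at t))"

definition transforms_into ::
  "('a::real_normed_vector \<Rightarrow> 'b::real_normed_vector) \<Rightarrow> 'a set \<Rightarrow>
    ('b \<Rightarrow> real \<Rightarrow> 'b) \<Rightarrow> ('a \<Rightarrow> real \<Rightarrow> 'a) \<Rightarrow> bool"
  where "transforms_into f U F G \<longleftrightarrow>
    (\<forall>T y. open T \<and> is_interval T \<and> smooth_on T y \<and> y ` T \<subseteq> U \<and> solves_on T F (\<lambda>t. f (y t))
      \<longrightarrow> solves_on T G y)"

end

theory Submission
  imports Defs
begin

text \<open>Write J for the Jacobian of f along the curve, F for H at a frozen time and K for F
  composed with f. The chain rule gives J y' = S grad F for the curve and grad K = J^T grad F for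
  the Hamiltonian (\<open>gradient_compose\<close>). In the plane J^T S J = (det J) S
  (\<open>S_mat_conjugation\<close>), so the two relations combine to S grad K = (det J) y'
  (\<open>hamiltonian_pullback\<close>). The polar decomposition turns det J into det Q times
  sqrt(det g) (\<open>polar_decomposition_det\<close>), and dividing by it gives the system. The
  sign is the same on the whole region because det J is continuous and never zero on a connected set
  (\<open>connected_nonvanishing_sign\<close>).\<close>

lemma smooth_on_imp_differentiable:
  assumes "smooth_on U f" "x \<in> U"
  shows "f differentiable (at x)"
proof -
  have "Ck_on (Suc 0) U f"
    using assms(1) unfolding smooth_on_def by blast
  then show ?thesis
    using assms(2) by simp
qed

lemma smooth_on_imp_continuous_on_frechet_derivative:
  assumes "smooth_on U f"
  shows "continuous_on U (\<lambda>x. frechet_derivative f (at x) v)"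
proof -
  have "Ck_on (Suc 0) U f"
    using assms unfolding smooth_on_def by blast
  then show ?thesis
    by simp
qed

text \<open>\<open>partial_deriv\<close> is built on \<open>deriv\<close>, which is meaningful only
  where a derivative exists; restricting the Frechet derivative to the line through x along the axis
  provides one.\<close>

lemma gradient_component_eq_derivative:
  fixes F :: "real^'n \<Rightarrow> real"
  assumes "(F has_derivative F') (at x)"
  shows "gradient F x $ m = F' (axis m 1)"
proof -
  have "((\<lambda>s. x + s *\<^sub>R axis m (1::real)) has_derivative (\<lambda>s. s *\<^sub>R axis m 1)) (at 0)"
    by (auto intro!: derivative_eq_intros)
  moreover have "(F has_derivative F') (at (x + 0 *\<^sub>R axis m (1::real)))"
    using assms by simp
  ultimately have "((\<lambda>s. F (x + s *\<^sub>R axis m 1)) has_derivative (\<lambda>s. F' (s *\<^sub>R axis m 1))) (at 0)"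
    using has_derivative_compose by blast
  moreover have "F' (s *\<^sub>R axis m 1) = F' (axis m 1) * s" for s
    using linear_cmul[OF has_derivative_linear[OF assms]] by simp
  ultimately have "((\<lambda>s. F (x + s *\<^sub>R axis m 1)) has_field_derivative F' (axis m 1)) (at 0)"
    by (simp add: has_field_derivative_def)
  then show ?thesis
    by (simp add: gradient_def partial_deriv_def DERIV_imp_deriv)
qed

lemma derivative_eq_inner_gradient:
  fixes F :: "real^'n \<Rightarrow> real"
  assumes "(F has_derivative F') (at x)"
  shows "F' v = gradient F x \<bullet> v"
proof -
  have lin: "linear F'"
    using assms by (rule has_derivative_linear)
  have "F' v = F' (\<Sum>i\<in>UNIV. v $ i *\<^sub>R axis i 1)"
    by (metis (no_types) basis_expansion scalar_mult_eq_scaleR sum.cong)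
  also have "\<dots> = (\<Sum>i\<in>UNIV. v $ i * gradient F x $ i)"
    by (simp add: linear_sum[OF lin] linear_cmul[OF lin] gradient_component_eq_derivative[OF assms])
  finally show ?thesis
    by (simp add: inner_vec_def mult.commute)
qed

text \<open>The derivative of the composite sends v to the inner product of grad F with J v; moving
  J to the other side as its adjoint exhibits the gradient.\<close>

lemma gradient_compose:
  fixes f :: "real^'n \<Rightarrow> real^'m" and F :: "real^'m \<Rightarrow> real"
  assumes "f differentiable (at y)" "F differentiable (at (f y))"
    and "open U" "y \<in> U" and eq: "\<And>z. z \<in> U \<Longrightarrow> K z = F (f z)"
  shows "gradient K y = transpose (jacobian f (at y)) *v gradient F (f y)"
proof -
  let ?J = "jacobian f (at y)"
  obtain F' where F': "(F has_derivative F') (at (f y))"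
    using assms(2) unfolding differentiable_def by blast
  have "((\<lambda>z. F (f z)) has_derivative (\<lambda>v. F' (?J *v v))) (at y)"
    using has_derivative_compose[OF assms(1)[unfolded jacobian_works] F'] .
  \<comment> \<open>K agrees with the composite only on U, so openness of U is what transfers the
    derivative.\<close>
  then have K': "(K has_derivative (\<lambda>v. F' (?J *v v))) (at y)"
    by (rule has_derivative_transform_within_open[OF _ assms(3,4)]) (simp add: eq)
  have "gradient K y \<bullet> v = (transpose ?J *v gradient F (f y)) \<bullet> v" for v
    using derivative_eq_inner_gradient[OF K', of v] derivative_eq_inner_gradient[OF F', of "?J *v v"]
    by (simp add: dot_lmul_matrix)
  then show ?thesis
    by (metis vector_eq_rdot)
qed

text \<open>A linear map of the plane scales the area form by its determinant: A^T S A = (det A) S.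
  The minus sign comes from the extra factor S, as S^2 = -I.\<close>

lemma S_mat_conjugation:
  fixes A :: "real^2^2"
  shows "S_mat *v (transpose A *v (S_mat *v (A *v w))) = - det A *\<^sub>R w"
  by (simp add: vec_eq_iff forall_2 matrix_vector_mult_def S_mat_def transpose_def det_2 sum_2
      algebra_simps)

lemma S_mat_S_mat: "S_mat *v (S_mat *v w) = - w"
  by (simp add: vec_eq_iff forall_2 matrix_vector_mult_def S_mat_def sum_2)

lemma positive_definite_imp_det_pos:
  fixes h :: "real^2^2"
  assumes "positive_definite h"
  shows "det h > 0"
proof -
  have sym: "h $ 2 $ 1 = h $ 1 $ 2"
    using assms unfolding positive_definite_def transpose_def
    by (metis (no_types, lifting) vec_lambda_beta)
  have pos: "v \<bullet> (h *v v) > 0" if "v \<noteq> 0" for v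
    using assms that unfolding positive_definite_def by blast
  have "0 < axis 1 1 \<bullet> (h *v axis 1 1)"
    by (rule pos) (simp add: axis_eq_0_iff)
  then have h11: "0 < h $ 1 $ 1"
    by (simp add: inner_vec_def matrix_vector_mult_def sum_2 axis_def)
  \<comment> \<open>Unnormalised Gram-Schmidt: v is orthogonal to the first axis for the form h,
    since h v = (0, det h). Hence the form takes the value h11 det h at v.\<close>
  define v :: "real^2" where "v = vector [- h $ 1 $ 2, h $ 1 $ 1]"
  have "v $ 2 \<noteq> 0"
    using h11 by (simp add: v_def)
  then have "0 < v \<bullet> (h *v v)"
    by (intro pos) auto
  also have "v \<bullet> (h *v v) = h $ 1 $ 1 * det h"
    by (simp add: v_def inner_vec_def matrix_vector_mult_def sum_2 det_2 sym algebra_simps)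
  finally show ?thesis
    using h11 by (simp add: zero_less_mult_iff)
qed

text \<open>Since det g = (det h)^2 and det h > 0, the root is det h itself; the rest is
  multiplicativity of the determinant.\<close>

lemma polar_decomposition_det:
  fixes A :: "real^2^2"
  assumes "polar_decomposition A Q h"
  shows "det A = det Q * sqrt (det (transpose h ** h))" "sqrt (det (transpose h ** h)) > 0"
proof -
  have "det h > 0"
    using assms positive_definite_imp_det_pos unfolding polar_decomposition_def by blast
  then have "sqrt (det (transpose h ** h)) = det h" "det h > 0"
    by (simp_all add: det_mul)
  then show "det A = det Q * sqrt (det (transpose h ** h))" "sqrt (det (transpose h ** h)) > 0"
    using assms unfolding polar_decomposition_def by (simp_all add: det_mul)
qed

text \<open>The determinant is a polynomial in the entries of the Jacobian, which are components of
  directional derivatives of f.\<close>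

lemma continuous_on_det_jacobian:
  fixes f :: "real^'n \<Rightarrow> real^'n"
  assumes "smooth_on U f"
  shows "continuous_on U (\<lambda>y. det (jacobian f (at y)))"
  unfolding det_def jacobian_def matrix_def
  by (auto intro!: continuous_intros smooth_on_imp_continuous_on_frechet_derivative[OF assms])

text \<open>The image of d is an interval, so values on both sides of 0 would force the value
  0.\<close>

lemma connected_nonvanishing_sign:
  fixes d :: "'a::topological_space \<Rightarrow> real"
  assumes "connected U" "continuous_on U d" and nz: "\<And>y. y \<in> U \<Longrightarrow> d y \<noteq> 0"
  shows "(\<forall>y\<in>U. d y > 0) \<or> (\<forall>y\<in>U. d y < 0)"
proof (rule ccontr)
  assume "\<not> ?thesis"
  then obtain a b where ab: "a \<in> U" "b \<in> U" "d a \<le> 0" "0 \<le> d b"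
    by (meson not_le_imp_less)
  have "connected (d ` U)"
    using assms connected_continuous_image by blast
  then have "0 \<in> d ` U"
    using ab unfolding connected_iff_interval by blast
  then show False
    using nz by force
qed

text \<open>\<open>J\<close> is never inverted: \<open>J y' = S \<nabla>F\<close> gives \<open>\<nabla>F = - S J y'\<close>, hence
  \<open>S \<nabla>K = S J\<^sup>T \<nabla>F = - S J\<^sup>T S J y' = det J y'\<close>.\<close>

lemma hamiltonian_pullback:
  fixes f :: "real^2 \<Rightarrow> real^2" and F K :: "real^2 \<Rightarrow> real"
  assumes "f differentiable (at (y t))" "F differentiable (at (f (y t)))"
    and "open U" "y t \<in> U" and "\<And>z. z \<in> U \<Longrightarrow> K z = F (f z)"
    and y: "(y has_vector_derivative y') (at t)"
    and sol: "((\<lambda>t. f (y t)) has_vector_derivative S_mat *v gradient F (f (y t))) (at t)"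
  shows "S_mat *v gradient K (y t) = det (jacobian f (at (y t))) *\<^sub>R y'"
proof -
  let ?J = "jacobian f (at (y t))"
  have "((\<lambda>t. f (y t)) has_vector_derivative ?J *v y') (at t)"
    using has_derivative_compose[OF y[unfolded has_vector_derivative_def]
        assms(1)[unfolded jacobian_works]]
    by (simp add: has_vector_derivative_def matrix_vector_mult_scaleR)
  then have "?J *v y' = S_mat *v gradient F (f (y t))"
    using sol by (rule vector_derivative_unique_at)
  then have "gradient F (f (y t)) = - (S_mat *v (?J *v y'))"
    by (simp add: S_mat_S_mat)
  then have "S_mat *v gradient K (y t) = - (S_mat *v (transpose ?J *v (S_mat *v (?J *v y'))))"
    using gradient_compose[OF assms(1-5)] by (simp add: vec.neg)
  then show ?thesis
    unfolding S_mat_conjugation by simp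
qed

theorem mainTheorem4:
  fixes H Ht :: "real^2 \<Rightarrow> real \<Rightarrow> real"
    and f :: "real^2 \<Rightarrow> real^2"
    and U V :: "(real^2) set"
    and Q h g :: "real^2 \<Rightarrow> real^2^2"
  assumes "smooth_on UNIV (\<lambda>(x, t). H x t)"
    and "region U" and "region V" and "f ` U \<subseteq> V"
    and "smooth_on U f"
    and "\<And>y. y \<in> U \<Longrightarrow> invertible (jacobian f (at y))"
    and "\<And>y. y \<in> U \<Longrightarrow> polar_decomposition (jacobian f (at y)) (Q y) (h y)"
    and "\<And>y. y \<in> U \<Longrightarrow> g y = transpose (h y) ** h y"
    and "\<And>y t. y \<in> U \<Longrightarrow> Ht y t = H (f y) t"
  shows "((\<forall>y\<in>U. det (Q y) = 1) \<or> (\<forall>y\<in>U. det (Q y) = -1)) \<and>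
    ((\<forall>y\<in>U. det (Q y) = 1) \<longrightarrow>
      transforms_into f U
        (\<lambda>x t. S_mat *v gradient (\<lambda>x. H x t) x)
        (\<lambda>y t. (1 / sqrt (det (g y))) *\<^sub>R (S_mat *v gradient (\<lambda>y. Ht y t) y))) \<and>
    ((\<forall>y\<in>U. det (Q y) = -1) \<longrightarrow>
      transforms_into f U
        (\<lambda>x t. S_mat *v gradient (\<lambda>x. H x t) x)
        (\<lambda>y t. - (1 / sqrt (det (g y))) *\<^sub>R (S_mat *v gradient (\<lambda>y. Ht y t) y)))"
proof -
  let ?J = "\<lambda>y. jacobian f (at y)"
  have U: "open U" "connected U"
    using assms(2) unfolding region_def by auto
  have detJ: "det (?J y) = det (Q y) * sqrt (det (g y))" and sqrt_pos: "sqrt (det (g y)) > 0"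
    if "y \<in> U" for y
    using polar_decomposition_det[OF assms(7)[OF that]] assms(8)[OF that] by simp_all
  have detQ: "det (Q y) = 1 \<or> det (Q y) = -1" if "y \<in> U" for y
    using det_orthogonal_matrix assms(7)[OF that] unfolding polar_decomposition_def by blast
  have "det (?J y) \<noteq> 0" if "y \<in> U" for y
    using assms(6)[OF that] invertible_det_nz by blast
  then have "(\<forall>y\<in>U. det (?J y) > 0) \<or> (\<forall>y\<in>U. det (?J y) < 0)"
    using connected_nonvanishing_sign[OF U(2) continuous_on_det_jacobian[OF assms(5)]] by blast
  \<comment> \<open>The factor sqrt(det g) is positive, so det Q has the sign of det J, and its only
    possible values are 1 and -1.\<close>
  then have sign: "(\<forall>y\<in>U. det (Q y) = 1) \<or> (\<forall>y\<in>U. det (Q y) = -1)"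
    by (smt (verit) detJ detQ sqrt_pos zero_less_mult_iff mult_less_0_iff)
  \<comment> \<open>Joint smoothness of H is restricted to a fixed time by composing with the affine
    embedding of x as (x, t).\<close>
  have H_diff: "(\<lambda>x. H x t) differentiable (at x)" for x t
  proof -
    have "(\<lambda>(x, t). H x t) differentiable (at (x, t))"
      using smooth_on_imp_differentiable[OF assms(1)] by blast
    then obtain D where D: "((\<lambda>(x, t). H x t) has_derivative D) (at (x, t))"
      unfolding differentiable_def by blast
    have "((\<lambda>x. (x, t)) has_derivative (\<lambda>v. (v, 0))) (at x)"
      by (auto intro!: derivative_eq_intros)
    from has_derivative_compose[OF this D] show ?thesis
      unfolding differentiable_def by auto
  qed
  \<comment> \<open>Both signs are treated at once: c is the common value of det Q, and c * c = 1
    makes c its own inverse, so dividing by c sqrt(det g) leaves c in the numerator.\<close>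
  have transforms: "transforms_into f U
      (\<lambda>x t. S_mat *v gradient (\<lambda>x. H x t) x)
      (\<lambda>y t. (c / sqrt (det (g y))) *\<^sub>R (S_mat *v gradient (\<lambda>y. Ht y t) y))"
    if c: "c * c = 1" and Qc: "\<forall>y\<in>U. det (Q y) = c" for c
    unfolding transforms_into_def solves_on_def
  proof (intro allI impI ballI, elim conjE)
    fix T y t
    assume y: "smooth_on T y" "y ` T \<subseteq> U" and t: "t \<in> T"
      and sol: "\<forall>t\<in>T. ((\<lambda>t. f (y t)) has_vector_derivative
        S_mat *v gradient (\<lambda>x. H x t) (f (y t))) (at t)"
    \<comment> \<open>Smoothness of the curve supplies the derivative; only its value remains to be
      identified.\<close>
    obtain y' where y': "(y has_vector_derivative y') (at t)"
      using smooth_on_imp_differentiable[OF y(1) t] vector_derivative_works by blast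
    have yt: "y t \<in> U"
      using y(2) t by blast
    have "S_mat *v gradient (\<lambda>y. Ht y t) (y t) = det (?J (y t)) *\<^sub>R y'"
      using hamiltonian_pullback[OF smooth_on_imp_differentiable[OF assms(5) yt] H_diff U(1) yt
          assms(9) y'] sol t by blast
    also have "\<dots> = (c * sqrt (det (g (y t)))) *\<^sub>R y'"
      using detJ[OF yt] Qc yt by simp
    finally have "(c / sqrt (det (g (y t)))) *\<^sub>R (S_mat *v gradient (\<lambda>y. Ht y t) (y t)) = (c * c) *\<^sub>R y'"
      using sqrt_pos[OF yt] by simp
    then show "(y has_vector_derivative
        (c / sqrt (det (g (y t)))) *\<^sub>R (S_mat *v gradient (\<lambda>y. Ht y t) (y t))) (at t)"
      using y' c by simp
  qed
  show ?thesis
    using sign transforms[of 1] transforms[of "-1"] by simp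
qed

end
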